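(* For $n=2$, there are $16$ cubic permutation polynomials over the T-quaternion ring $\mathcal{S}_{\mathbb{Z}_{n}}=\mathcal{S}_{\mathbb{Z}_2}$, of which none are complete permutation polynomials.
   Context: For a commutative unital ring $\mathbf{R}$, let $\mathcal{H}_{\mathbf{R}}=\{w+xi+yj+zk : w,x,y,z\in\mathbf{R}\}$ be the ring of quaternions over $\mathbf{R}$, with componentwise addition and multiplication determined by $i^2=j^2=k^2=-1$, $ij=k$, $jk=i$, $ki=j$, $ji=-k$, $kj=-i$, $ik=-j$. The T-quaternion ring over $\mathbf{R}$ is the commutative unital subring $\mathcal{S}_{\mathbf{R}}=\{w+a(i+j+k) : w,a\in\mathbf{R}\}$ of $\mathcal{H}_{\mathbf{R}}$. $\mathbb{Z}_n$ is the ring of integers modulo $n$. A polynomial $f(X)\in\mathcal{S}_{\mathbb{Z}_n}[X]$ is a permutation polynomial over $\mathcal{S}_{\mathbb{Z}_n}$ if the induced map $f:\mathcal{S}_{\mathbb{Z}_n}\to\mathcal{S}_{\mathbb{Z}_n}$ is a bijection; it is a complete permutation polynomial if both $f(X)$ and $f(X)+X$ are permutation polynomials. A cubic polynomial is $f(X)=AX^3+BX^2+CX+D$ with $A,B,C,D\in\mathcal{S}_{\mathbb{Z}_n}$, $A\neq 0$; polynomials are counted by their coefficients (including the constant term), not as functions. *)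

theory Defs
  imports "HOL-Algebra.Polynomial_Divisibility" "HOL-Number_Theory.Residues"
begin

text \<open>\<open>Quat w x y z\<close> stands for \<open>w + x i + y j + z k\<close>.\<close>

datatype 'a quat = Quat 'a 'a 'a 'a

fun quat_add :: "('a, 'm) ring_scheme \<Rightarrow> 'a quat \<Rightarrow> 'a quat \<Rightarrow> 'a quat" where
  "quat_add R (Quat w x y z) (Quat w' x' y' z') =
     Quat (w \<oplus>\<^bsub>R\<^esub> w') (x \<oplus>\<^bsub>R\<^esub> x') (y \<oplus>\<^bsub>R\<^esub> y') (z \<oplus>\<^bsub>R\<^esub> z')"

fun quat_mult :: "('a, 'm) ring_scheme \<Rightarrow> 'a quat \<Rightarrow> 'a quat \<Rightarrow> 'a quat" where
  "quat_mult R (Quat w x y z) (Quat w' x' y' z') =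
     Quat (w \<otimes>\<^bsub>R\<^esub> w' \<ominus>\<^bsub>R\<^esub> x \<otimes>\<^bsub>R\<^esub> x' \<ominus>\<^bsub>R\<^esub> y \<otimes>\<^bsub>R\<^esub> y' \<ominus>\<^bsub>R\<^esub> z \<otimes>\<^bsub>R\<^esub> z')
          (w \<otimes>\<^bsub>R\<^esub> x' \<oplus>\<^bsub>R\<^esub> x \<otimes>\<^bsub>R\<^esub> w' \<oplus>\<^bsub>R\<^esub> y \<otimes>\<^bsub>R\<^esub> z' \<ominus>\<^bsub>R\<^esub> z \<otimes>\<^bsub>R\<^esub> y')
          (w \<otimes>\<^bsub>R\<^esub> y' \<ominus>\<^bsub>R\<^esub> x \<otimes>\<^bsub>R\<^esub> z' \<oplus>\<^bsub>R\<^esub> y \<otimes>\<^bsub>R\<^esub> w' \<oplus>\<^bsub>R\<^esub> z \<otimes>\<^bsub>R\<^esub> x')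
          (w \<otimes>\<^bsub>R\<^esub> z' \<oplus>\<^bsub>R\<^esub> x \<otimes>\<^bsub>R\<^esub> y' \<ominus>\<^bsub>R\<^esub> y \<otimes>\<^bsub>R\<^esub> x' \<oplus>\<^bsub>R\<^esub> z \<otimes>\<^bsub>R\<^esub> w')"

definition quaternion_ring :: "('a, 'm) ring_scheme \<Rightarrow> 'a quat ring" where
  "quaternion_ring R =
     \<lparr>carrier = {Quat w x y z | w x y z.
        w \<in> carrier R \<and> x \<in> carrier R \<and> y \<in> carrier R \<and> z \<in> carrier R},
      monoid.mult = quat_mult R,
      one = Quat \<one>\<^bsub>R\<^esub> \<zero>\<^bsub>R\<^esub> \<zero>\<^bsub>R\<^esub> \<zero>\<^bsub>R\<^esub>,
      zero = Quat \<zero>\<^bsub>R\<^esub> \<zero>\<^bsub>R\<^esub> \<zero>\<^bsub>R\<^esub> \<zero>\<^bsub>R\<^esub>,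
      add = quat_add R\<rparr>"

definition tquaternions :: "('a, 'm) ring_scheme \<Rightarrow> 'a quat set" where
  "tquaternions R = {Quat w a a a | w a. w \<in> carrier R \<and> a \<in> carrier R}"

definition tquaternion_ring :: "('a, 'm) ring_scheme \<Rightarrow> 'a quat ring" where
  "tquaternion_ring R = (quaternion_ring R)\<lparr>carrier := tquaternions R\<rparr>"

definition quat_i :: "('a, 'm) ring_scheme \<Rightarrow> 'a quat" where
  "quat_i R = Quat \<zero>\<^bsub>R\<^esub> \<one>\<^bsub>R\<^esub> \<zero>\<^bsub>R\<^esub> \<zero>\<^bsub>R\<^esub>"

definition quat_j :: "('a, 'm) ring_scheme \<Rightarrow> 'a quat" where
  "quat_j R = Quat \<zero>\<^bsub>R\<^esub> \<zero>\<^bsub>R\<^esub> \<one>\<^bsub>R\<^esub> \<zero>\<^bsub>R\<^esub>"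

definition quat_k :: "('a, 'm) ring_scheme \<Rightarrow> 'a quat" where
  "quat_k R = Quat \<zero>\<^bsub>R\<^esub> \<zero>\<^bsub>R\<^esub> \<zero>\<^bsub>R\<^esub> \<one>\<^bsub>R\<^esub>"

lemma (in cring) quat_mult_assoc:
  assumes "p \<in> carrier (quaternion_ring R)" "q \<in> carrier (quaternion_ring R)" "r \<in> carrier (quaternion_ring R)"
  shows "quat_mult R (quat_mult R p q) r = quat_mult R p (quat_mult R q r)"
  using assms
  by (clarsimp simp: quaternion_ring_def)
    (simp add: a_minus_def l_distr r_distr l_minus r_minus minus_add m_assoc a_ac)

lemma (in cring) quat_distr_right:
  assumes "p \<in> carrier (quaternion_ring R)" "q \<in> carrier (quaternion_ring R)" "r \<in> carrier (quaternion_ring R)"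
  shows "quat_mult R (quat_add R p q) r = quat_add R (quat_mult R p r) (quat_mult R q r)"
  using assms
  by (clarsimp simp: quaternion_ring_def)
    (simp add: a_minus_def l_distr r_distr l_minus r_minus minus_add m_assoc a_ac)

lemma (in cring) quat_distr_left:
  assumes "p \<in> carrier (quaternion_ring R)" "q \<in> carrier (quaternion_ring R)" "r \<in> carrier (quaternion_ring R)"
  shows "quat_mult R r (quat_add R p q) = quat_add R (quat_mult R r p) (quat_mult R r q)"
  using assms
  by (clarsimp simp: quaternion_ring_def)
    (simp add: a_minus_def l_distr r_distr l_minus r_minus minus_add m_assoc a_ac)

lemma quaternion_ring_is_ring:
  assumes "cring R"
  shows "ring (quaternion_ring R)"
proof -
  interpret cring R by fact
  have neg: "\<exists>y\<in>carrier (quaternion_ring R). quat_add R y p = Quat \<zero>\<^bsub>R\<^esub> \<zero>\<^bsub>R\<^esub> \<zero>\<^bsub>R\<^esub> \<zero>\<^bsub>R\<^esub>"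
    if "p \<in> carrier (quaternion_ring R)" for p
  proof -
    from that obtain w x y z where "p = Quat w x y z"
      "w \<in> carrier R" "x \<in> carrier R" "y \<in> carrier R" "z \<in> carrier R"
      by (auto simp: quaternion_ring_def)
    then show ?thesis
      by (intro bexI[of _ "Quat (\<ominus>\<^bsub>R\<^esub> w) (\<ominus>\<^bsub>R\<^esub> x) (\<ominus>\<^bsub>R\<^esub> y) (\<ominus>\<^bsub>R\<^esub> z)"])
        (auto simp: quaternion_ring_def l_neg)
  qed
  have ops: "monoid.mult (quaternion_ring R) = quat_mult R" "add (quaternion_ring R) = quat_add R"
    by (simp_all add: quaternion_ring_def)
  show ?thesis
  proof (rule ringI)
    show "abelian_group (quaternion_ring R)"
      using neg by (intro abelian_groupI) (auto simp: quaternion_ring_def a_ac)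
    show "monoid (quaternion_ring R)"
    proof (rule monoidI)
      fix p q r
      assume "p \<in> carrier (quaternion_ring R)" "q \<in> carrier (quaternion_ring R)"
        "r \<in> carrier (quaternion_ring R)"
      then show "p \<otimes>\<^bsub>quaternion_ring R\<^esub> q \<otimes>\<^bsub>quaternion_ring R\<^esub> r
          = p \<otimes>\<^bsub>quaternion_ring R\<^esub> (q \<otimes>\<^bsub>quaternion_ring R\<^esub> r)"
        unfolding ops by (rule quat_mult_assoc)
    qed (auto simp: quaternion_ring_def a_minus_def)
  qed (simp_all only: ops quat_distr_left quat_distr_right)
qed

lemma quat_basis_mult:
  assumes "cring R"
  defines "H \<equiv> quaternion_ring R"
    and "i \<equiv> quat_i R" and "j \<equiv> quat_j R" and "k \<equiv> quat_k R"
  shows "i \<otimes>\<^bsub>H\<^esub> i = \<ominus>\<^bsub>H\<^esub> \<one>\<^bsub>H\<^esub>" "j \<otimes>\<^bsub>H\<^esub> j = \<ominus>\<^bsub>H\<^esub> \<one>\<^bsub>H\<^esub>" "k \<otimes>\<^bsub>H\<^esub> k = \<ominus>\<^bsub>H\<^esub> \<one>\<^bsub>H\<^esub>"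
    and "i \<otimes>\<^bsub>H\<^esub> j = k" "j \<otimes>\<^bsub>H\<^esub> k = i" "k \<otimes>\<^bsub>H\<^esub> i = j"
    and "j \<otimes>\<^bsub>H\<^esub> i = \<ominus>\<^bsub>H\<^esub> k" "k \<otimes>\<^bsub>H\<^esub> j = \<ominus>\<^bsub>H\<^esub> i" "i \<otimes>\<^bsub>H\<^esub> k = \<ominus>\<^bsub>H\<^esub> j"
proof -
  interpret cring R by fact
  interpret H: ring H unfolding H_def by (rule quaternion_ring_is_ring) fact
  have neg: "\<ominus>\<^bsub>H\<^esub> Quat w x y z = Quat (\<ominus>\<^bsub>R\<^esub> w) (\<ominus>\<^bsub>R\<^esub> x) (\<ominus>\<^bsub>R\<^esub> y) (\<ominus>\<^bsub>R\<^esub> z)"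
    if "w \<in> carrier R" "x \<in> carrier R" "y \<in> carrier R" "z \<in> carrier R" for w x y z
    using that by (intro H.minus_equality) (auto simp: H_def quaternion_ring_def l_neg)
  have one: "\<one>\<^bsub>H\<^esub> = Quat \<one>\<^bsub>R\<^esub> \<zero>\<^bsub>R\<^esub> \<zero>\<^bsub>R\<^esub> \<zero>\<^bsub>R\<^esub>" and mult: "monoid.mult H = quat_mult R"
    by (simp_all add: H_def quaternion_ring_def)
  show "i \<otimes>\<^bsub>H\<^esub> i = \<ominus>\<^bsub>H\<^esub> \<one>\<^bsub>H\<^esub>" "j \<otimes>\<^bsub>H\<^esub> j = \<ominus>\<^bsub>H\<^esub> \<one>\<^bsub>H\<^esub>" "k \<otimes>\<^bsub>H\<^esub> k = \<ominus>\<^bsub>H\<^esub> \<one>\<^bsub>H\<^esub>"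
    "i \<otimes>\<^bsub>H\<^esub> j = k" "j \<otimes>\<^bsub>H\<^esub> k = i" "k \<otimes>\<^bsub>H\<^esub> i = j"
    "j \<otimes>\<^bsub>H\<^esub> i = \<ominus>\<^bsub>H\<^esub> k" "k \<otimes>\<^bsub>H\<^esub> j = \<ominus>\<^bsub>H\<^esub> i" "i \<otimes>\<^bsub>H\<^esub> k = \<ominus>\<^bsub>H\<^esub> j"
    by (simp_all add: i_def j_def k_def quat_i_def quat_j_def quat_k_def one mult neg a_minus_def)
qed

lemma tquaternions_subcring:
  assumes "cring R"
  shows "subcring (tquaternions R) (quaternion_ring R)"
proof -
  interpret cring R by fact
  interpret H: ring "quaternion_ring R" by (rule quaternion_ring_is_ring) fact
  have neg: "\<ominus>\<^bsub>quaternion_ring R\<^esub> Quat w a a a =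
      Quat (\<ominus>\<^bsub>R\<^esub> w) (\<ominus>\<^bsub>R\<^esub> a) (\<ominus>\<^bsub>R\<^esub> a) (\<ominus>\<^bsub>R\<^esub> a)"
    if "w \<in> carrier R" "a \<in> carrier R" for w a
    using that by (intro H.minus_equality) (auto simp: quaternion_ring_def l_neg)
  have cancel: "p \<oplus>\<^bsub>R\<^esub> (q \<oplus>\<^bsub>R\<^esub> (r \<oplus>\<^bsub>R\<^esub> \<ominus>\<^bsub>R\<^esub> p)) = q \<oplus>\<^bsub>R\<^esub> r"
    if "p \<in> carrier R" "q \<in> carrier R" "r \<in> carrier R" for p q r
    using that by algebra
  have mult: "quat_mult R (Quat w a a a) (Quat w' a' a' a') =
      Quat (w \<otimes>\<^bsub>R\<^esub> w' \<ominus>\<^bsub>R\<^esub> a \<otimes>\<^bsub>R\<^esub> a' \<ominus>\<^bsub>R\<^esub> a \<otimes>\<^bsub>R\<^esub> a' \<ominus>\<^bsub>R\<^esub> a \<otimes>\<^bsub>R\<^esub> a')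
        (w \<otimes>\<^bsub>R\<^esub> a' \<oplus>\<^bsub>R\<^esub> a \<otimes>\<^bsub>R\<^esub> w') (w \<otimes>\<^bsub>R\<^esub> a' \<oplus>\<^bsub>R\<^esub> a \<otimes>\<^bsub>R\<^esub> w') (w \<otimes>\<^bsub>R\<^esub> a' \<oplus>\<^bsub>R\<^esub> a \<otimes>\<^bsub>R\<^esub> w')"
    if "w \<in> carrier R" "a \<in> carrier R" "w' \<in> carrier R" "a' \<in> carrier R" for w a w' a'
    using that by (simp add: a_minus_def a_ac cancel)
  have "subring (tquaternions R) (quaternion_ring R)"
  proof (rule H.subringI)
    show "\<ominus>\<^bsub>quaternion_ring R\<^esub> h \<in> tquaternions R" if "h \<in> tquaternions R" for h
      using that neg by (auto simp: tquaternions_def)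
    show "g \<otimes>\<^bsub>quaternion_ring R\<^esub> h \<in> tquaternions R"
      if "g \<in> tquaternions R" "h \<in> tquaternions R" for g h
      using that by (auto simp: tquaternions_def quaternion_ring_def mult simp del: quat_mult.simps)
  qed (auto simp: tquaternions_def quaternion_ring_def)
  moreover have "g \<otimes>\<^bsub>quaternion_ring R\<^esub> h = h \<otimes>\<^bsub>quaternion_ring R\<^esub> g"
    if "g \<in> tquaternions R" "h \<in> tquaternions R" for g h
    using that
    by (auto simp: tquaternions_def quaternion_ring_def mult m_comm a_comm simp del: quat_mult.simps)
  ultimately show ?thesis
    by (simp add: subcring_def subcring_axioms_def)
qed

lemma tquaternion_ring_is_cring:
  assumes "cring R"
  shows "cring (tquaternion_ring R)"
  using ring.subcring_iff[OF quaternion_ring_is_ring[OF assms]]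
    tquaternions_subcring[OF assms] subcring.axioms(1) subringE(1)
  unfolding tquaternion_ring_def by blast

definition permutation_polynomial :: "('a, 'm) ring_scheme \<Rightarrow> 'a list \<Rightarrow> bool" where
  "permutation_polynomial S f \<longleftrightarrow>
     f \<in> carrier (poly_ring S) \<and> bij_betw (ring.eval S f) (carrier S) (carrier S)"

definition complete_permutation_polynomial :: "('a, 'm) ring_scheme \<Rightarrow> 'a list \<Rightarrow> bool" where
  "complete_permutation_polynomial S f \<longleftrightarrow>
     permutation_polynomial S f \<and> permutation_polynomial S (f \<oplus>\<^bsub>poly_ring S\<^esub> X\<^bsub>S\<^esub>)"

definition cubic_polynomials :: "('a, 'm) ring_scheme \<Rightarrow> 'a list set" where
  "cubic_polynomials S = {f \<in> carrier (poly_ring S). degree f = 3}"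

end

theory Submission
  imports Defs
begin

text \<open>
  With \<open>t = i + j + k\<close>, the ring is \<open>\<int>\<^sub>2[t]/(t\<^sup>2 - 1)\<close>, a local ring with four elements whose maximal
  ideal is \<open>{0, 1 + t}\<close> and whose units are \<open>1\<close> and \<open>t\<close>. A finite check shows that
  \<open>A X\<^sup>3 + B X\<^sup>2 + C X + D\<close> permutes it iff \<open>A\<close> and \<open>B\<close> lie in the maximal ideal and \<open>C\<close> is a unit;
  with \<open>A \<noteq> 0\<close> this leaves \<open>1 \<sqdot> 2 \<sqdot> 2 \<sqdot> 4\<close> choices. Adding \<open>X\<close> turns the unit \<open>C\<close> into the non-unit
  \<open>C + 1\<close>, so no such polynomial is complete.
\<close>

text \<open>Two coordinates replace four: \<open>tq w a\<close> is \<open>w + a t\<close> in the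
  notation above. Through \<open>add_S2\<close> and \<open>mult_S2\<close> the simplifier can then
  compute without unfolding quaternions.\<close>

definition tq :: "int \<Rightarrow> int \<Rightarrow> int quat" where
  "tq w a = Quat w a a a"

abbreviation S2 :: "int quat ring" where
  "S2 \<equiv> tquaternion_ring (residue_ring 2)"

lemma tq_inject [simp]: "tq w a = tq w' a' \<longleftrightarrow> w = w' \<and> a = a'"
  by (auto simp: tq_def)

lemma cring_S2: "cring S2"
proof -
  interpret residues 2 "residue_ring 2" by unfold_locales auto
  show ?thesis by (rule tquaternion_ring_is_cring) (rule is_cring)
qed

interpretation S2: cring S2
  by (rule cring_S2)

lemma carrier_S2: "carrier S2 = {tq 0 0, tq 0 1, tq 1 0, tq 1 1}"
proof -
  have "{0..1::int} = {0, 1}" by auto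
  then show ?thesis
    by (auto simp: tquaternion_ring_def tquaternions_def residue_ring_def tq_def)
qed

lemma zero_S2: "\<zero>\<^bsub>S2\<^esub> = tq 0 0" and one_S2: "\<one>\<^bsub>S2\<^esub> = tq 1 0"
  by (simp_all add: tquaternion_ring_def quaternion_ring_def residue_ring_def tq_def)

lemma add_S2: "tq w a \<oplus>\<^bsub>S2\<^esub> tq w' a' = tq ((w + w') mod 2) ((a + a') mod 2)"
  by (simp add: tquaternion_ring_def quaternion_ring_def residue_ring_def tq_def)

lemma mult_S2: "tq w a \<otimes>\<^bsub>S2\<^esub> tq w' a' = tq ((w * w' + a * a') mod 2) ((w * a' + a * w') mod 2)"
proof -
  interpret residues 2 "residue_ring 2" by unfold_locales auto
  \<comment> \<open>Signs vanish modulo 2, so \<open>t^2 = -3\<close> becomes 1; the cross terms in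
    the imaginary components occur twice and cancel by \<open>dbl\<close> and
    \<open>dbl'\<close>.\<close>
  have sub: "x \<ominus>\<^bsub>residue_ring 2\<^esub> y = (x + y) mod 2" for x y :: int
    unfolding a_minus_def res_neg_eq res_add_eq by presburger
  have dbl: "(z + x + x) mod 2 = z mod 2" for x z :: int
    by presburger
  have dbl': "(z + x + y + x) mod 2 = (z + y) mod 2" for x y z :: int
    by presburger
  show ?thesis
    by (simp add: tquaternion_ring_def quaternion_ring_def tq_def res_mult_eq res_add_eq sub
        mod_simps dbl dbl')
qed

text \<open>Horner's scheme removes the powers in \<open>eval\<close>, leaving only sums and
  products to compute.\<close>

lemma (in ring) eval_cubic:
  assumes "{a, b, c, d, x} \<subseteq> carrier R"
  shows "eval [a, b, c, d] x = ((a \<otimes> x \<oplus> b) \<otimes> x \<oplus> c) \<otimes> x \<oplus> d"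
  using assms by (simp add: numeral_3_eq_3 numeral_2_eq_2 l_distr a_assoc m_assoc)

text \<open>Put \<open>e = 1 + t\<close>. Since \<open>e^2 = 0\<close> and \<open>2 = 0\<close>, one
  has \<open>f(x + e) - f(x) = (A x^2 + C) e\<close>, which is nonzero for all \<open>x\<close> iff
  \<open>C\<close> and \<open>A + C\<close> are units, that is, \<open>C\<close> is a unit and
  \<open>A\<close> lies in the ideal \<open>{0, e}\<close>. Separating the two cosets of the ideal
  needs \<open>A + B + C\<close> to be a unit, which then puts \<open>B\<close> in the
  ideal.\<close>

lemma cubic_permutes_S2_iff:
  assumes "{A, B, C, D} \<subseteq> carrier S2"
  shows "bij_betw (S2.eval [A, B, C, D]) (carrier S2) (carrier S2) \<longleftrightarrow>
    A \<in> {tq 0 0, tq 1 1} \<and> B \<in> {tq 0 0, tq 1 1} \<and> C \<in> {tq 1 0, tq 0 1}"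
proof -
  have "S2.eval [A, B, C, D] ` carrier S2 \<subseteq> carrier S2"
    using assms by (auto intro!: S2.eval_in_carrier)
  moreover have "finite (carrier S2)"
    by (simp add: carrier_S2)
  ultimately have "bij_betw (S2.eval [A, B, C, D]) (carrier S2) (carrier S2) \<longleftrightarrow>
      inj_on (S2.eval [A, B, C, D]) (carrier S2)"
    by (metis bij_betw_def endo_inj_surj)
  also have "\<dots> \<longleftrightarrow> inj_on (\<lambda>x. ((A \<otimes>\<^bsub>S2\<^esub> x \<oplus>\<^bsub>S2\<^esub> B) \<otimes>\<^bsub>S2\<^esub> x \<oplus>\<^bsub>S2\<^esub> C) \<otimes>\<^bsub>S2\<^esub> x \<oplus>\<^bsub>S2\<^esub> D) (carrier S2)"
    using assms by (intro inj_on_cong S2.eval_cubic) auto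
  \<comment> \<open>Translation by \<open>D\<close> preserves injectivity; dropping it leaves 64
    triples \<open>A, B, C\<close> to check.\<close>
  also have "\<dots> \<longleftrightarrow> inj_on (\<lambda>x. ((A \<otimes>\<^bsub>S2\<^esub> x \<oplus>\<^bsub>S2\<^esub> B) \<otimes>\<^bsub>S2\<^esub> x \<oplus>\<^bsub>S2\<^esub> C) \<otimes>\<^bsub>S2\<^esub> x) (carrier S2)"
    using assms by (simp add: inj_on_def)
  also have "\<dots> \<longleftrightarrow> A \<in> {tq 0 0, tq 1 1} \<and> B \<in> {tq 0 0, tq 1 1} \<and> C \<in> {tq 1 0, tq 0 1}"
  proof -
    have "A = tq 0 0 \<or> A = tq 0 1 \<or> A = tq 1 0 \<or> A = tq 1 1"
      "B = tq 0 0 \<or> B = tq 0 1 \<or> B = tq 1 0 \<or> B = tq 1 1"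
      "C = tq 0 0 \<or> C = tq 0 1 \<or> C = tq 1 0 \<or> C = tq 1 1"
      using assms unfolding carrier_S2 by simp_all
    then show ?thesis
      unfolding carrier_S2 by (elim disjE; simp add: add_S2 mult_S2)
  qed
  finally show ?thesis .
qed

lemma cubic_polynomials_S2:
  "cubic_polynomials S2 = {[A, B, C, D] | A B C D. {A, B, C, D} \<subseteq> carrier S2 \<and> A \<noteq> \<zero>\<^bsub>S2\<^esub>}"
proof -
  \<comment> \<open>\<open>degree f\<close> is the truncated \<open>length f - 1\<close>, so the
    empty list has degree 0 and is excluded.\<close>
  have "length f - 1 = 3 \<longleftrightarrow> (\<exists>A B C D. f = [A, B, C, D])" for f :: "int quat list"
  proof -
    have "length f - 1 = 3 \<longleftrightarrow> length f = Suc (Suc (Suc (Suc 0)))"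
      by arith
    then show ?thesis
      by (simp only: length_Suc_conv length_0_conv) blast
  qed
  then show ?thesis
    by (fastforce simp: cubic_polynomials_def univ_poly_carrier[symmetric] polynomial_def)
qed

text \<open>The list \<open>[1, 0]\<close> of \<open>X\<close> is padded with leading zeros; as
  \<open>A\<close> is nonzero, normalisation strips nothing from the sum.\<close>

lemma add_X_cubic:
  assumes "{A, B, C, D} \<subseteq> carrier S2" "A \<noteq> \<zero>\<^bsub>S2\<^esub>"
  shows "[A, B, C, D] \<oplus>\<^bsub>poly_ring S2\<^esub> X\<^bsub>S2\<^esub> = [A, B, C \<oplus>\<^bsub>S2\<^esub> \<one>\<^bsub>S2\<^esub>, D]"
  using assms by (simp add: univ_poly_def var_def numeral_2_eq_2)

theorem proposition22:
  fixes S :: "int quat ring"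
  defines "S \<equiv> tquaternion_ring (residue_ring 2)"
  shows "card {f \<in> cubic_polynomials S. permutation_polynomial S f} = 16
    \<and> {f \<in> cubic_polynomials S. complete_permutation_polynomial S f} = {}"
proof
  let ?F = "{f \<in> cubic_polynomials S2. permutation_polynomial S2 f}"
  \<comment> \<open>The admissible coefficient tuples: a nonzero \<open>A\<close> in the ideal can
    only be \<open>tq 1 1\<close>.\<close>
  let ?P = "{tq 1 1} \<times> {tq 0 0, tq 1 1} \<times> {tq 1 0, tq 0 1} \<times> carrier S2"
  have S2_elems: "tq 0 0 \<in> carrier S2" "tq 0 1 \<in> carrier S2" "tq 1 0 \<in> carrier S2" "tq 1 1 \<in> carrier S2"
    by (simp_all add: carrier_S2)
  have P: "{A, B, C, D} \<subseteq> carrier S2 \<and> A \<noteq> \<zero>\<^bsub>S2\<^esub> \<and> A \<in> {tq 0 0, tq 1 1} \<and>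
      B \<in> {tq 0 0, tq 1 1} \<and> C \<in> {tq 1 0, tq 0 1} \<longleftrightarrow> (A, B, C, D) \<in> ?P" for A B C D
    using S2_elems unfolding zero_S2 by auto
  have perm: "({A, B, C, D} \<subseteq> carrier S2 \<and> A \<noteq> \<zero>\<^bsub>S2\<^esub>) \<and>
      bij_betw (S2.eval [A, B, C, D]) (carrier S2) (carrier S2) \<longleftrightarrow> (A, B, C, D) \<in> ?P" for A B C D
    unfolding P[symmetric] conj_assoc by (intro conj_cong refl cubic_permutes_S2_iff)
  have collect: "{f \<in> {[A, B, C, D] | A B C D. Q A B C D}. b f} =
      {[A, B, C, D] | A B C D. Q A B C D \<and> b [A, B, C, D]}"
    for Q :: "int quat \<Rightarrow> int quat \<Rightarrow> int quat \<Rightarrow> int quat \<Rightarrow> bool" and b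
    by auto
  have "?F = {f \<in> cubic_polynomials S2. bij_betw (S2.eval f) (carrier S2) (carrier S2)}"
    by (auto simp: permutation_polynomial_def cubic_polynomials_def)
  also have "\<dots> = {[A, B, C, D] | A B C D. (A, B, C, D) \<in> ?P}"
    by (simp only: cubic_polynomials_S2 collect perm)
  finally have F: "?F = {[A, B, C, D] | A B C D. (A, B, C, D) \<in> ?P}" .
  have image: "{[A, B, C, D] | A B C D. (A, B, C, D) \<in> P} = (\<lambda>(A, B, C, D). [A, B, C, D]) ` P"
    for P :: "(int quat \<times> int quat \<times> int quat \<times> int quat) set"
    by force
  have "card ?F = card ?P"
    unfolding F image by (rule card_image) (rule inj_onI, clarify, simp)
  also have "\<dots> = 16"
    by (simp add: carrier_S2 card_cartesian_product)
  finally show "card {f \<in> cubic_polynomials S. permutation_polynomial S f} = 16"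
    unfolding S_def .
  have "\<not> complete_permutation_polynomial S2 f" if "f \<in> cubic_polynomials S2" for f
  proof
    assume "complete_permutation_polynomial S2 f"
    then have f: "f \<in> ?F" and fX: "permutation_polynomial S2 (f \<oplus>\<^bsub>poly_ring S2\<^esub> X\<^bsub>S2\<^esub>)"
      using that by (simp_all add: complete_permutation_polynomial_def)
    from f obtain A B C D where ABCD: "f = [A, B, C, D]" "(A, B, C, D) \<in> ?P"
      unfolding F by blast
    then have mem: "{A, B, C, D} \<subseteq> carrier S2" "A \<noteq> \<zero>\<^bsub>S2\<^esub>" and C: "C \<in> {tq 1 0, tq 0 1}"
      unfolding P[symmetric] by blast+
    then have mem': "{A, B, C \<oplus>\<^bsub>S2\<^esub> \<one>\<^bsub>S2\<^esub>, D} \<subseteq> carrier S2"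
      by simp
    have "bij_betw (S2.eval [A, B, C \<oplus>\<^bsub>S2\<^esub> \<one>\<^bsub>S2\<^esub>, D]) (carrier S2) (carrier S2)"
      using fX unfolding ABCD(1) add_X_cubic[OF mem] permutation_polynomial_def by blast
    \<comment> \<open>The criterion applied to \<open>f + X\<close> makes \<open>C + 1\<close> a
      unit, but a unit plus 1 is 0 or \<open>1 + t\<close>.\<close>
    then have "C \<oplus>\<^bsub>S2\<^esub> \<one>\<^bsub>S2\<^esub> \<in> {tq 1 0, tq 0 1}"
      unfolding cubic_permutes_S2_iff[OF mem'] by blast
    with C show False
      by (auto simp: one_S2 add_S2)
  qed
  then show "{f \<in> cubic_polynomials S. complete_permutation_polynomial S f} = {}"
    unfolding S_def by blast
qed

end
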